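(* There is a task representable by a deterministic context-free language $\mathcal{L}$ (over a finite alphabet) such that every counting reward automaton (CRA), with any finite number of counters, that encodes $\mathcal{L}$ incurs, for episodes of length $n$, a blowup of $\Omega(2^n)$ in the size of the CRA policy.
   Context: A counter machine (CM) is a deterministic finite automaton with finitely many states, a set of accepting states and a fixed finite number of counters holding natural numbers (initially $0$); each transition depends on the current state, on the next input symbol (or $\epsilon$, for silent transitions that read no input) and on which counters are zero, and it changes the state and adds a fixed integer vector to the counters (keeping them non-negative). Determinism: in each configuration (state together with counter values) at most one transition is applicable for each next input symbol, and if a silent transition is applicable then no other transition is. A word is accepted if, after reading it entirely and then making zero or more silent transitions, the machine is in an accepting state. A counting reward automaton (CRA) is a counter machine that additionally outputs a real-valued reward on each transition. A CRA encodes the task given by a language $\mathcal{L}$ if its underlying counter machine recognises $\mathcal{L}$. A CRA policy has access to the values of all counters at each timestep, and it is viewed as a table. The counter configuration (tuple of counter values) at timestep $t$ is the one reached after reading $t$ input symbols and executing all silent transitions that are then taken before the machine must read the next symbol. In episodes of length $n$ the policy is consulted at timesteps $t=0,\dots,n-1$. The blowup in the size of the CRA policy is the number of distinct counter configurations occurring at these timesteps over all input words of length $n$. The bound $\Omega(2^n)$ is asymptotic as $n\to\infty$, for each fixed CRA encoding the task (the hidden constant may depend on the CRA). *)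

theory Defs
  imports Complex_Main "HOL-Library.Landau_Symbols"
begin

section \<open>Runs of automata with silent moves\<close>

text \<open>A step relation is labelled with \<open>Some a\<close> for moves reading \<open>a\<close> and with \<open>None\<close> for silent moves.
  A run on \<open>w\<close> may contain silent moves anywhere, in particular after the last symbol of \<open>w\<close>.\<close>

inductive run :: "('a option \<Rightarrow> 'c \<Rightarrow> 'c \<Rightarrow> bool) \<Rightarrow> 'c \<Rightarrow> 'a list \<Rightarrow> 'c \<Rightarrow> bool"
  for step :: "'a option \<Rightarrow> 'c \<Rightarrow> 'c \<Rightarrow> bool" where
  refl: "run step c [] c"
| silent: "step None c c' \<Longrightarrow> run step c' w c'' \<Longrightarrow> run step c w c''"
| read: "step (Some a) c c' \<Longrightarrow> run step c' w c'' \<Longrightarrow> run step c (a # w) c''"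


section \<open>Deterministic context-free languages\<close>

record ('s, 'a, 'g) dpda =
  pda_states :: "'s set"
  pda_alphabet :: "'a set"
  pda_stack_alphabet :: "'g set"
  pda_initial :: 's
  pda_bottom :: 'g
  pda_final :: "'s set"
  pda_trans :: "'s \<Rightarrow> 'a option \<Rightarrow> 'g \<Rightarrow> ('s \<times> 'g list) option"

definition dpda_wf :: "('s, 'a, 'g) dpda \<Rightarrow> bool" where
  "dpda_wf P \<longleftrightarrow>
     finite (pda_states P) \<and> finite (pda_alphabet P) \<and> finite (pda_stack_alphabet P) \<and>
     pda_initial P \<in> pda_states P \<and> pda_bottom P \<in> pda_stack_alphabet P \<and>
     pda_final P \<subseteq> pda_states P \<and>
     (\<forall>q \<in> pda_states P. \<forall>X \<in> pda_stack_alphabet P.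
        (\<forall>x p \<gamma>. set_option x \<subseteq> pda_alphabet P \<and> pda_trans P q x X = Some (p, \<gamma>) \<longrightarrow>
           p \<in> pda_states P \<and> set \<gamma> \<subseteq> pda_stack_alphabet P) \<and>
        (pda_trans P q None X \<noteq> None \<longrightarrow>
           (\<forall>a \<in> pda_alphabet P. pda_trans P q (Some a) X = None)))"

text \<open>The top of the stack is the head of the list; there is no move on the empty stack.\<close>

inductive pda_step ::
  "('s, 'a, 'g) dpda \<Rightarrow> 'a option \<Rightarrow> 's \<times> 'g list \<Rightarrow> 's \<times> 'g list \<Rightarrow> bool"
  for P :: "('s, 'a, 'g) dpda" where
  "pda_trans P q x X = Some (p, \<gamma>) \<Longrightarrow> pda_step P x (q, X # \<beta>) (p, \<gamma> @ \<beta>)"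

definition pda_language :: "('s, 'a, 'g) dpda \<Rightarrow> 'a list set" where
  "pda_language P = {w \<in> lists (pda_alphabet P).
     \<exists>q \<beta>. run (pda_step P) (pda_initial P, [pda_bottom P]) w (q, \<beta>) \<and> q \<in> pda_final P}"

text \<open>States and stack symbols form finite sets, so taking them to be natural numbers
  loses no generality.\<close>

definition deterministic_context_free :: "'a set \<Rightarrow> 'a list set \<Rightarrow> bool" where
  "deterministic_context_free \<Sigma> L \<longleftrightarrow>
     (\<exists>P :: (nat, 'a, nat) dpda. dpda_wf P \<and> pda_alphabet P = \<Sigma> \<and> pda_language P = L)"


section \<open>Counter machines and counting reward automata\<close>

text \<open>Counter values are lists of length \<open>cm_dim\<close>. The guard \<open>tr_zeros\<close> is the exact set of indices
  of the counters that are zero.\<close>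

record ('s, 'a) transition =
  tr_source :: 's
  tr_input :: "'a option"
  tr_zeros :: "nat set"
  tr_target :: 's
  tr_update :: "int list"

record ('s, 'a) cm =
  cm_states :: "'s set"
  cm_alphabet :: "'a set"
  cm_dim :: nat
  cm_initial :: 's
  cm_accepting :: "'s set"
  cm_transitions :: "('s, 'a) transition set"

record ('s, 'a) cra = "('s, 'a) cm" +
  cra_reward :: "('s, 'a) transition \<Rightarrow> real"

text \<open>A transition that would make some counter negative is not applicable.\<close>

definition applicable ::
  "('s, 'a, 'z) cm_scheme \<Rightarrow> ('s, 'a) transition \<Rightarrow> 's \<times> nat list \<Rightarrow> bool" where
  "applicable M t = (\<lambda>(q, v).
     t \<in> cm_transitions M \<and> tr_source t = q \<and> tr_zeros t = {i. i < length v \<and> v ! i = 0} \<and>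
     (\<forall>i < length v. 0 \<le> int (v ! i) + tr_update t ! i))"

definition fire :: "('s, 'a) transition \<Rightarrow> 's \<times> nat list \<Rightarrow> 's \<times> nat list" where
  "fire t = (\<lambda>(q, v). (tr_target t, map2 (\<lambda>x d. nat (int x + d)) v (tr_update t)))"

definition cm_step ::
  "('s, 'a, 'z) cm_scheme \<Rightarrow> 'a option \<Rightarrow> 's \<times> nat list \<Rightarrow> 's \<times> nat list \<Rightarrow> bool" where
  "cm_step M x c c' \<longleftrightarrow> (\<exists>t. applicable M t c \<and> tr_input t = x \<and> c' = fire t c)"

definition cm_deterministic :: "('s, 'a, 'z) cm_scheme \<Rightarrow> bool" where
  "cm_deterministic M \<longleftrightarrow>
     (\<forall>q \<in> cm_states M. \<forall>v. length v = cm_dim M \<longrightarrow>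
        (\<forall>t t'. applicable M t (q, v) \<and> applicable M t' (q, v) \<and>
           (tr_input t = tr_input t' \<or> tr_input t = None) \<longrightarrow> t = t'))"

definition counter_machine :: "('s, 'a, 'z) cm_scheme \<Rightarrow> bool" where
  "counter_machine M \<longleftrightarrow>
     finite (cm_states M) \<and> finite (cm_alphabet M) \<and> finite (cm_transitions M) \<and>
     cm_initial M \<in> cm_states M \<and> cm_accepting M \<subseteq> cm_states M \<and>
     (\<forall>t \<in> cm_transitions M.
        tr_source t \<in> cm_states M \<and> tr_target t \<in> cm_states M \<and>
        set_option (tr_input t) \<subseteq> cm_alphabet M \<and>
        tr_zeros t \<subseteq> {..<cm_dim M} \<and> length (tr_update t) = cm_dim M) \<and>
     cm_deterministic M"

definition cm_start :: "('s, 'a, 'z) cm_scheme \<Rightarrow> 's \<times> nat list" where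
  "cm_start M = (cm_initial M, replicate (cm_dim M) 0)"

definition cm_language :: "('s, 'a, 'z) cm_scheme \<Rightarrow> 'a list set" where
  "cm_language M = {w \<in> lists (cm_alphabet M).
     \<exists>q v. run (cm_step M) (cm_start M) w (q, v) \<and> q \<in> cm_accepting M}"

definition cra_encodes :: "('s, 'a) cra \<Rightarrow> 'a set \<Rightarrow> 'a list set \<Rightarrow> bool" where
  "cra_encodes M \<Sigma> L \<longleftrightarrow> counter_machine M \<and> cm_alphabet M = \<Sigma> \<and> cm_language M = L"


section \<open>Size of the policy table\<close>

text \<open>The counter values once all silent transitions following the word \<open>u\<close> have been executed.
  No such values exist if the machine gets stuck within \<open>u\<close> or never stops making silent moves;
  by determinism there is at most one such tuple.\<close>

definition settled_counters :: "('s, 'a, 'z) cm_scheme \<Rightarrow> 'a list \<Rightarrow> nat list \<Rightarrow> bool" where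
  "settled_counters M u v \<longleftrightarrow>
     (\<exists>q. run (cm_step M) (cm_start M) u (q, v) \<and> (\<nexists>c. cm_step M None (q, v) c))"

definition policy_counters :: "('s, 'a) cra \<Rightarrow> nat \<Rightarrow> nat list set" where
  "policy_counters M n =
     {v. \<exists>w \<in> lists (cm_alphabet M). length w = n \<and> (\<exists>t < n. settled_counters M (take t w) v)}"

text \<open>For a well-formed machine the set is finite, the alphabet being finite.\<close>

definition policy_blowup :: "('s, 'a) cra \<Rightarrow> nat \<Rightarrow> nat" where
  "policy_blowup M n = card (policy_counters M n)"

end

(* The language of words u 2 u^R with u over {0, 1} has 2^k prefixes of length k of which no two
   have a common right context.  A machine that accepts a continuation of each of them must settle
   in pairwise different configurations, and a configuration consists of one of finitely many
   states and of the counter values.  This leaves at least 2^(n - 1) / |Q| counter values at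
   timestep n - 1. *)

theory Submission
  imports Defs
begin

section \<open>Runs of deterministic step relations\<close>

lemma run_append:
  "run step c u d \<Longrightarrow> run step d z e \<Longrightarrow> run step c (u @ z) e"
  by (induction rule: run.induct) (auto intro: run.intros)

text \<open>Relative to a set closed under steps, since \<open>cm_deterministic\<close> constrains
  only configurations with a state in \<open>cm_states\<close> and the right number of counters.
  With \<open>x = None\<close> the clause also excludes reading moves beside a silent one.\<close>

definition deterministic_on :: "('a option \<Rightarrow> 'c \<Rightarrow> 'c \<Rightarrow> bool) \<Rightarrow> 'c set \<Rightarrow> bool" where
  "deterministic_on step S \<longleftrightarrow>
     (\<forall>c \<in> S. \<forall>x d. step x c d \<longrightarrow>
        d \<in> S \<and> (\<forall>y e. step y c e \<and> (x = y \<or> x = None) \<longrightarrow> x = y \<and> d = e))"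

lemma deterministic_on_closed:
  "deterministic_on step S \<Longrightarrow> c \<in> S \<Longrightarrow> step x c d \<Longrightarrow> d \<in> S"
  unfolding deterministic_on_def by blast

lemma deterministic_on_unique:
  "deterministic_on step S \<Longrightarrow> c \<in> S \<Longrightarrow> step x c d \<Longrightarrow> step x c e \<Longrightarrow> d = e"
  unfolding deterministic_on_def by blast

lemma deterministic_on_silent:
  "deterministic_on step S \<Longrightarrow> c \<in> S \<Longrightarrow> step None c d \<Longrightarrow> \<not> step (Some a) c e"
  unfolding deterministic_on_def by blast

text \<open>Both runs are forced to make the same moves. That neither endpoint admits a silent move
  fixes where trailing silent moves stop, which the word alone leaves open.\<close>

lemma settled_run_unique:
  assumes det: "deterministic_on step S"
    and "run step c w d" "c \<in> S" "\<nexists>d'. step None d d'"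
    and "run step c w e" "\<nexists>e'. step None e e'"
  shows "d = e"
  using assms(2-)
proof (induction rule: run.induct)
  case (refl c)
  from \<open>run step c [] e\<close> refl show ?case by cases auto
next
  case (silent c c' w c'')
  from \<open>run step c w e\<close> show ?case
  proof cases
    case refl
    with silent show ?thesis by blast
  next
    case (silent c2)
    then show ?thesis
      using det deterministic_on_closed[OF det] deterministic_on_unique[OF det]
        \<open>step None c c'\<close> silent.IH silent.prems by metis
  next
    case (read a c2 w')
    then show ?thesis
      using deterministic_on_silent[OF det \<open>c \<in> S\<close> \<open>step None c c'\<close>] by blast
  qed
next
  case (read a c c' w c'')
  from \<open>run step c (a # w) e\<close> show ?case
  proof cases
    case (silent c2)
    then show ?thesis
      using deterministic_on_silent[OF det \<open>c \<in> S\<close>] \<open>step (Some a) c c'\<close> by blast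
  next
    case (read c2)
    then show ?thesis
      using deterministic_on_closed[OF det] deterministic_on_unique[OF det]
        \<open>step (Some a) c c'\<close> read.IH read.prems by metis
  qed
qed

text \<open>Cut the run just before \<open>a\<close> is read: by determinism, a configuration that
  reads a symbol admits no silent move.\<close>

lemma run_settles_before_read:
  assumes det: "deterministic_on step S"
    and "run step c (u @ a # z) e" "c \<in> S"
  shows "\<exists>d \<in> S. run step c u d \<and> (\<nexists>d'. step None d d') \<and> run step d (a # z) e"
  using assms(2-)
proof (induction c "u @ a # z" e arbitrary: u rule: run.induct)
  case refl
  then show ?case by simp
next
  case (silent c c' e)
  then show ?case
    using deterministic_on_closed[OF det] run.silent by metis
next
  case (read b c c' w e)
  show ?case
  proof (cases u)
    case Nil
    with read have "\<nexists>d'. step None c d'"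
      using deterministic_on_silent[OF det \<open>c \<in> S\<close>] by blast
    with Nil read show ?thesis
      by (auto intro!: bexI[of _ c] intro: run.intros)
  next
    case (Cons b' u')
    with read have "b' = b" "w = u' @ a # z" by auto
    with read obtain d where "d \<in> S" "run step c' u' d" "\<nexists>d'. step None d d'"
        "run step d (a # z) e"
      using deterministic_on_closed[OF det] by metis
    with read Cons \<open>b' = b\<close> show ?thesis by (blast intro: run.intros)
  qed
qed


section \<open>Counter values distinguish the elements of a fooling set\<close>

definition cm_configs :: "('s, 'a, 'z) cm_scheme \<Rightarrow> ('s \<times> nat list) set" where
  "cm_configs M = cm_states M \<times> {v. length v = cm_dim M}"

lemma cm_start_config:
  "counter_machine M \<Longrightarrow> cm_start M \<in> cm_configs M"
  by (simp add: counter_machine_def cm_start_def cm_configs_def)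

lemma cm_step_deterministic_on:
  assumes "counter_machine M"
  shows "deterministic_on (cm_step M) (cm_configs M)"
  unfolding deterministic_on_def
proof (intro ballI allI impI conjI)
  fix c x d
  assume c: "c \<in> cm_configs M" and d: "cm_step M x c d"
  obtain q v where qv: "c = (q, v)" by fastforce
  from d obtain t where t: "applicable M t c" "tr_input t = x" "d = fire t c"
    by (auto simp: cm_step_def)
  have "t \<in> cm_transitions M"
    using t(1) by (simp add: qv applicable_def)
  \<comment> \<open>The matching lengths keep \<open>map2\<close> in \<open>fire\<close> from
    truncating the counter list.\<close>
  then have "tr_target t \<in> cm_states M" "length (tr_update t) = cm_dim M"
    using assms by (auto simp: counter_machine_def)
  then show "d \<in> cm_configs M"
    using c t by (simp add: qv fire_def cm_configs_def)
  fix y e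
  assume e: "cm_step M y c e \<and> (x = y \<or> x = None)"
  then obtain t' where t': "applicable M t' c" "tr_input t' = y" "e = fire t' c"
    by (auto simp: cm_step_def)
  have "t = t'"
    using assms c t t' e
    by (auto simp: qv counter_machine_def cm_deterministic_def cm_configs_def)
  then show "x = y" "d = e"
    using t t' by auto
qed

text \<open>Each word settles in at most one tuple, and finitely many words have length at most
  \<open>n\<close>. Finiteness matters because \<open>card\<close> of an infinite set is 0, which
  would void a lower bound obtained by injection.\<close>

lemma finite_policy_counters:
  assumes "counter_machine M"
  shows "finite (policy_counters M n)"
proof -
  let ?W = "{u. set u \<subseteq> cm_alphabet M \<and> length u \<le> n}"
  have "settled_counters M u v \<Longrightarrow> settled_counters M u v' \<Longrightarrow> v = v'" for u v v'
    unfolding settled_counters_def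
    using settled_run_unique[OF cm_step_deterministic_on[OF assms] _ cm_start_config[OF assms]]
    by (metis prod.inject)
  then have *: "v = (THE v. settled_counters M u v)" if "settled_counters M u v" for u v
    using that by (metis the_equality)
  \<comment> \<open>For a word that never settles, \<open>THE\<close> yields an unspecified value,
    which is harmless for an inclusion.\<close>
  have "policy_counters M n \<subseteq> (\<lambda>u. THE v. settled_counters M u v) ` ?W"
  proof
    fix v
    assume "v \<in> policy_counters M n"
    then obtain w t where "w \<in> lists (cm_alphabet M)" "length w = n"
        "settled_counters M (take t w) v"
      by (auto simp: policy_counters_def)
    then show "v \<in> (\<lambda>u. THE v. settled_counters M u v) ` ?W"
      using * set_take_subset[of t w] by (intro image_eqI[of _ _ "take t w"]) auto
  qed
  moreover have "finite ?W"
    using assms by (intro finite_lists_length_le) (simp add: counter_machine_def)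
  ultimately show ?thesis
    by (rule finite_subset[OF _ finite_imageI])
qed

text \<open>Two words that settle in the same configuration accept the same continuations, so
  \<open>u\<close> determines its configuration injectively. A nonempty \<open>z u\<close> forces
  the machine to settle after \<open>u\<close>; acceptance of \<open>u\<close> alone would not. The
  factor counts the states, which \<open>policy_blowup\<close> leaves out.\<close>

lemma card_fooling_set_le_policy_blowup:
  assumes M: "counter_machine M"
    and short: "\<And>u. u \<in> U \<Longrightarrow> length u < n"
    and nonempty: "\<And>u. u \<in> U \<Longrightarrow> z u \<noteq> []"
    and accept: "\<And>u. u \<in> U \<Longrightarrow> u @ z u \<in> cm_language M"
    and fooling: "\<And>u u'. u \<in> U \<Longrightarrow> u' \<in> U \<Longrightarrow> u' @ z u \<in> cm_language M \<Longrightarrow> u' = u"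
  shows "card U \<le> card (cm_states M) * policy_blowup M n"
proof -
  note det = cm_step_deterministic_on[OF M]
  have "\<exists>c. c \<in> cm_states M \<times> policy_counters M n \<and> run (cm_step M) (cm_start M) u c \<and>
      (\<exists>q v. run (cm_step M) c (z u) (q, v) \<and> q \<in> cm_accepting M)" if u: "u \<in> U" for u
  proof -
    obtain a y where z: "z u = a # y"
      using nonempty[OF u] by (cases "z u") auto
    obtain q v where run: "run (cm_step M) (cm_start M) (u @ a # y) (q, v)"
      and q: "q \<in> cm_accepting M" and alph: "u @ a # y \<in> lists (cm_alphabet M)"
      using accept[OF u] by (auto simp: z cm_language_def)
    obtain p v' where d: "(p, v') \<in> cm_configs M" "run (cm_step M) (cm_start M) u (p, v')"
      "\<nexists>d. cm_step M None (p, v') d" "run (cm_step M) (p, v') (a # y) (q, v)"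
      using run_settles_before_read[OF det run cm_start_config[OF M]] by force
    \<comment> \<open>Padding to a full episode of length \<open>n\<close>; the letter
      \<open>a\<close> lies in the alphabet because \<open>u @ z u\<close> is accepted.\<close>
    define w where "w = u @ replicate (n - length u) a"
    have "w \<in> lists (cm_alphabet M)" "length w = n" "take (length u) w = u"
      using alph short[OF u] by (auto simp: w_def)
    moreover have "settled_counters M u v'"
      using d by (auto simp: settled_counters_def)
    ultimately have "v' \<in> policy_counters M n"
      using short[OF u] unfolding policy_counters_def by (metis (mono_tags, lifting) mem_Collect_eq)
    with d q show ?thesis
      by (auto simp: z cm_configs_def intro!: exI[of _ "(p, v')"])
  qed
  then obtain c where c: "\<And>u. u \<in> U \<Longrightarrow> c u \<in> cm_states M \<times> policy_counters M n"
    and reach: "\<And>u. u \<in> U \<Longrightarrow> run (cm_step M) (cm_start M) u (c u)"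
    and acc: "\<And>u. u \<in> U \<Longrightarrow>
      \<exists>q v. run (cm_step M) (c u) (z u) (q, v) \<and> q \<in> cm_accepting M"
    by metis
  have "inj_on c U"
  proof (rule inj_onI)
    fix u u'
    assume u: "u \<in> U" "u' \<in> U" "c u = c u'"
    \<comment> \<open>Crossing the runs: the run on \<open>u'\<close> ends where the accepting run
      on \<open>z u\<close> begins.\<close>
    then obtain q v where "run (cm_step M) (cm_start M) (u' @ z u) (q, v)" "q \<in> cm_accepting M"
      using acc[of u] reach[of u'] run_append by metis
    moreover have "u' @ z u \<in> lists (cm_alphabet M)"
      using accept[of u] accept[of u'] u by (auto simp: cm_language_def)
    ultimately have "u' @ z u \<in> cm_language M"
      by (auto simp: cm_language_def)
    with fooling u show "u = u'" by blast
  qed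
  moreover have "finite (cm_states M \<times> policy_counters M n)"
    using M finite_policy_counters[OF M] by (simp add: counter_machine_def)
  ultimately have "card U \<le> card (cm_states M \<times> policy_counters M n)"
    using c by (intro card_inj_on_le[of c] image_subsetI)
  then show ?thesis
    by (simp add: card_cartesian_product policy_blowup_def)
qed


section \<open>Marked palindromes\<close>

definition marked_palindromes :: "nat list set" where
  "marked_palindromes = {u @ 2 # rev u |u. u \<in> lists {0, 1}}"

text \<open>The marker 2 occurs in neither half, so a word splits around it in only one way. This is
  the fooling property for the contexts \<open>2 # rev u\<close>.\<close>

lemma marked_palindrome_iff:
  assumes "u \<in> lists {0, 1}" "u' \<in> lists {0, 1}"
  shows "u' @ 2 # rev u \<in> marked_palindromes \<longleftrightarrow> u' = u"
proof
  assume "u' @ 2 # rev u \<in> marked_palindromes"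
  then obtain x where x: "u' @ 2 # rev u = x @ 2 # rev x" "x \<in> lists {0, 1}"
    by (auto simp: marked_palindromes_def)
  have "2 \<notin> set u'" "2 \<notin> set x" "2 \<notin> set (rev u)" "2 \<notin> set (rev x)"
    using assms x(2) by auto
  with x(1) show "u' = u"
    by (metis append_Cons_eq_iff rev_rev_ident)
qed (use assms in \<open>auto simp: marked_palindromes_def\<close>)

text \<open>State 0 pushes, state 1 matches, state 2 accepts; 2 also serves as the bottom symbol.\<close>

definition palindrome_trans :: "nat \<Rightarrow> nat option \<Rightarrow> nat \<Rightarrow> (nat \<times> nat list) option" where
  "palindrome_trans q x X =
     (case x of
        None \<Rightarrow> if q = 1 \<and> X = 2 then Some (2, [2]) else None
      | Some a \<Rightarrow>
          if q = 0 \<and> a < 2 then Some (0, [a, X])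
          else if q = 0 \<and> a = 2 then Some (1, [X])
          else if q = 1 \<and> a < 2 \<and> a = X then Some (1, [])
          else None)"

definition palindrome_dpda :: "(nat, nat, nat) dpda" where
  "palindrome_dpda =
     \<lparr>pda_states = {0, 1, 2}, pda_alphabet = {0, 1, 2}, pda_stack_alphabet = {0, 1, 2},
      pda_initial = 0, pda_bottom = 2, pda_final = {2}, pda_trans = palindrome_trans\<rparr>"

section \<open>Correctness of the pushdown automaton\<close>

lemma dpda_wf_palindrome_dpda: "dpda_wf palindrome_dpda"
  by (auto simp: dpda_wf_def palindrome_dpda_def palindrome_trans_def
      split: option.splits if_splits)

lemma palindrome_step_iff:
  "pda_step palindrome_dpda x (q, \<beta>) c \<longleftrightarrow>
     (\<exists>X \<gamma> p \<delta>. \<beta> = X # \<gamma> \<and> palindrome_trans q x X = Some (p, \<delta>) \<and> c = (p, \<delta> @ \<gamma>))"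
  by (auto simp: pda_step.simps palindrome_dpda_def)

text \<open>The induction needs an arbitrary stack: the part \<gamma> above the bottom is what
  remains to be matched. All three states are treated at once because a run passes from one to the
  next.\<close>

lemma palindrome_run_sound:
  assumes "run (pda_step palindrome_dpda) c w d" "fst d = 2"
    and "snd c = \<gamma> @ [2]" "\<gamma> \<in> lists {0, 1}"
  shows "(fst c = 0 \<longrightarrow> (\<exists>u \<in> lists {0, 1}. w = u @ 2 # rev u @ \<gamma>)) \<and>
    (fst c = 1 \<longrightarrow> w = \<gamma>) \<and> (fst c = 2 \<longrightarrow> w = [])"
  using assms
proof (induction arbitrary: \<gamma> rule: run.induct)
  case (refl c)
  then show ?case by simp
next
  case (silent c c' w d)
  obtain q where c: "c = (q, \<gamma> @ [2])"
    using silent.prems by (cases c) auto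
  \<comment> \<open>The silent move needs 2 on top of the stack, and \<gamma> contains no 2, so only
    the bottom is left.\<close>
  have "q = 1 \<and> \<gamma> = [] \<and> c' = (2, [2])"
    using silent.hyps silent.prems
    by (cases \<gamma>) (auto simp: c palindrome_step_iff palindrome_trans_def split: if_splits)
  then show ?case
    using silent.IH[of "[]"] silent.prems by (simp add: c)
next
  case (read a c c' w d)
  obtain q where c: "c = (q, \<gamma> @ [2])"
    using read.prems by (cases c) auto
  obtain X \<beta> where X: "\<gamma> @ [2] = X # \<beta>"
    by (cases "\<gamma> @ [2]") auto
  \<comment> \<open>State 2 has no moves, and popping requires \<open>a < 2\<close>, so the bottom
    symbol is never popped.\<close>
  consider (push) "q = 0" "a < 2" "c' = (0, (a # \<gamma>) @ [2])"
    | (mark) "q = 0" "a = 2" "c' = (1, \<gamma> @ [2])"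
    | (pop) \<gamma>' where "q = 1" "\<gamma> = a # \<gamma>'" "c' = (1, \<gamma>' @ [2])"
    using read.hyps(1) X
    by (cases \<gamma>) (auto simp: c palindrome_step_iff palindrome_trans_def split: if_splits)
  then show ?case
  proof cases
    case push
    then have "a \<in> {0, 1}" by auto
    \<comment> \<open>The pushed \<open>a\<close> is matched directly after \<open>rev u\<close>,
      and \<open>rev u @ [a]\<close> is \<open>rev (a # u)\<close>.\<close>
    with push obtain u where "u \<in> lists {0, 1}" "w = u @ 2 # rev u @ a # \<gamma>"
      using read.IH[of "a # \<gamma>"] read.prems by auto
    then have "a # u \<in> lists {0, 1}" "a # w = (a # u) @ 2 # rev (a # u) @ \<gamma>"
      using \<open>a \<in> {0, 1}\<close> by auto
    then show ?thesis
      using push unfolding c by (auto intro!: bexI[of _ "a # u"])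
  next
    case mark
    then show ?thesis
      using read.IH[of \<gamma>] read.prems by (auto simp: c intro!: bexI[of _ "[]"])
  next
    case pop
    then show ?thesis
      using read.IH[of \<gamma>'] read.prems by (simp add: c)
  qed
qed

lemma palindrome_run_push:
  "u \<in> lists {0, 1} \<Longrightarrow>
   run (pda_step palindrome_dpda) (0, \<gamma> @ [2]) u (0, rev u @ \<gamma> @ [2])"
proof (induction u arbitrary: \<gamma>)
  case Nil
  show ?case by (simp add: run.refl)
next
  case (Cons a u)
  \<comment> \<open>A move inspects the top symbol; if \<gamma> is empty, this is the bottom 2,
    hence the case split.\<close>
  have "pda_step palindrome_dpda (Some a) (0, \<gamma> @ [2]) (0, (a # \<gamma>) @ [2])"
    using Cons.prems by (cases \<gamma>) (auto simp: palindrome_step_iff palindrome_trans_def)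
  then show ?case
    using Cons.IH[of "a # \<gamma>"] Cons.prems by (auto intro: run.read)
qed

lemma palindrome_run_pop:
  "\<gamma> \<in> lists {0, 1} \<Longrightarrow> run (pda_step palindrome_dpda) (1, \<gamma> @ [2]) \<gamma> (2, [2])"
proof (induction \<gamma>)
  case Nil
  show ?case
    by (auto simp: palindrome_step_iff palindrome_trans_def intro: run.silent run.refl)
next
  case (Cons a \<gamma>)
  then have "pda_step palindrome_dpda (Some a) (1, (a # \<gamma>) @ [2]) (1, \<gamma> @ [2])"
    by (auto simp: palindrome_step_iff palindrome_trans_def)
  with Cons show ?case by (auto intro: run.read)
qed

lemma pda_language_palindrome_dpda: "pda_language palindrome_dpda = marked_palindromes"
proof
  show "pda_language palindrome_dpda \<subseteq> marked_palindromes"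
    using palindrome_run_sound[where \<gamma> = "[]"]
    by (fastforce simp: pda_language_def marked_palindromes_def palindrome_dpda_def)
  show "marked_palindromes \<subseteq> pda_language palindrome_dpda"
  proof
    fix w
    assume "w \<in> marked_palindromes"
    then obtain u where u: "w = u @ 2 # rev u" "u \<in> lists {0, 1}"
      by (auto simp: marked_palindromes_def)
    have "pda_step palindrome_dpda (Some 2) (0, rev u @ [2]) (1, rev u @ [2])"
      by (cases "rev u @ [2 :: nat]") (auto simp: palindrome_step_iff palindrome_trans_def)
    moreover have "run (pda_step palindrome_dpda) (1, rev u @ [2]) (rev u) (2, [2])"
      using u(2) by (intro palindrome_run_pop) auto
    ultimately have "run (pda_step palindrome_dpda) (0, [2]) w (2, [2])"
      using palindrome_run_push[OF u(2), of "[]"] u(1) by (auto intro: run_append run.read)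
    then show "w \<in> pda_language palindrome_dpda"
      using u by (auto simp: pda_language_def palindrome_dpda_def)
  qed
qed

section \<open>The exponential lower bound\<close>

lemma marked_palindromes_policy_blowup:
  assumes M: "cra_encodes M {0, 1, 2} marked_palindromes"
  shows "2 ^ n \<le> card (cm_states M) * policy_blowup M (Suc n)"
proof -
  \<comment> \<open>All binary words of length \<open>n\<close> form the fooling set. Timestep
    \<open>n\<close> is the last one consulted in an episode of length \<open>Suc n\<close>.\<close>
  let ?U = "{u. set u \<subseteq> {0, 1 :: nat} \<and> length u = n}"
  have "counter_machine M" "cm_language M = marked_palindromes"
    using M by (auto simp: cra_encodes_def)
  then have "card ?U \<le> card (cm_states M) * policy_blowup M (Suc n)"
    using marked_palindrome_iff
    by (intro card_fooling_set_le_policy_blowup[where z = "\<lambda>u. 2 # rev u"])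
      (auto simp: in_lists_conv_set subset_iff)
  moreover have "card ?U = 2 ^ n"
    by (subst card_lists_length_eq) (simp_all add: numeral_2_eq_2)
  ultimately show ?thesis by simp
qed

theorem theorem4:
  "\<exists>(\<Sigma> :: nat set) (L :: nat list set).
     finite \<Sigma> \<and> deterministic_context_free \<Sigma> L \<and>
     (\<forall>M :: (nat, nat) cra. cra_encodes M \<Sigma> L \<longrightarrow>
        (\<lambda>n. real (policy_blowup M n)) \<in> \<Omega>(\<lambda>n. 2 ^ n))"
proof (intro exI conjI allI impI)
  show "finite {0, 1, 2 :: nat}" by simp
  show "deterministic_context_free {0, 1, 2} marked_palindromes"
    unfolding deterministic_context_free_def
    using dpda_wf_palindrome_dpda pda_language_palindrome_dpda
    by (intro exI[of _ palindrome_dpda]) (simp add: palindrome_dpda_def)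
  fix M :: "(nat, nat) cra"
  assume M: "cra_encodes M {0, 1, 2} marked_palindromes"
  let ?k = "card (cm_states M)"
  \<comment> \<open>At exponent 0 the bound says that 1 is at most a multiple of \<open>?k\<close>,
    so \<open>?k\<close> cannot vanish.\<close>
  have k: "?k > 0"
    using marked_palindromes_policy_blowup[OF M, of 0] by (cases "?k = 0") auto
  \<comment> \<open>The factor 2 pays for the shift from \<open>n\<close> to \<open>n - 1\<close>.
    At \<open>n = 0\<close> the policy is never consulted and its size is 0, so the inequality
    starts at 1.\<close>
  have "1 / (2 * real ?k) * 2 ^ n \<le> real (policy_blowup M n)" if n1: "n \<ge> 1" for n
  proof -
    obtain m where n: "n = Suc m"
      using n1 by (cases n) auto
    have "real (2 ^ m) \<le> real (?k * policy_blowup M n)"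
      unfolding n of_nat_le_iff by (rule marked_palindromes_policy_blowup[OF M])
    then show ?thesis
      using k by (simp add: n field_simps)
  qed
  then have "\<forall>\<^sub>F n in at_top. 1 / (2 * real ?k) * norm ((2 :: real) ^ n)
      \<le> norm (real (policy_blowup M n))"
    by (intro eventually_at_top_linorderI[of 1]) simp
  then show "(\<lambda>n. real (policy_blowup M n)) \<in> \<Omega>(\<lambda>n. 2 ^ n)"
    using k by (intro landau_omega.bigI[of "1 / (2 * real ?k)"]) auto
qed

end
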